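(* The path graph $P_{2m}$ (on $2m$ vertices, without loops), viewed as a target graph, is Hoffman-London for all $m\ge 1$ and strongly Hoffman-London for all $m\ge 2$.
   Context: For a target graph $H$ and a simple loopless graph $G$, an $H$-coloring of $G$ is a map $f:V(G)\to V(H)$ such that $f(u)\sim_H f(v)$ whenever $u\sim_G v$; $\hom(G,H)$ denotes the number of $H$-colorings of $G$. $\mathcal{T}_n$ is the set of all trees on $n$ vertices (up to isomorphism) and $P_n\in\mathcal{T}_n$ is the path on $n$ vertices. $H$ is Hoffman-London if for all $n\ge 1$, $\hom(P_n,H)=\min_{T_n\in\mathcal{T}_n}\hom(T_n,H)$; $H$ is strongly Hoffman-London if $\hom(P_n,H)<\hom(T_n,H)$ for all $n\ge 1$ and all $T_n\in\mathcal{T}_n\setminus\{P_n\}$. *)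

theory Defs
  imports Graph_Theory.Graph_Theory "HOL-Library.FuncSet"
begin

text \<open>
  Undirected graphs are symmetric relations, represented by \<^typ>\<open>'a pair_pre_digraph\<close>: an edge
  between distinct vertices consists of two opposite arcs, a loop is one arc. The finite simple
  loopless graphs are given by the locale \<^locale>\<open>pair_graph\<close>; target graphs may have loops
  (\<^locale>\<open>pair_pseudo_graph\<close>).
\<close>

text \<open>The set of \<open>H\<close>-colorings of \<open>G\<close>. The extensional function space makes each map from the
  vertices of \<open>G\<close> to those of \<open>H\<close> count exactly once.\<close>

definition colorings :: "'a pair_pre_digraph \<Rightarrow> 'b pair_pre_digraph \<Rightarrow> ('a \<Rightarrow> 'b) set" where
  "colorings G H =
     {f \<in> pverts G \<rightarrow>\<^sub>E pverts H. \<forall>u v. (u, v) \<in> parcs G \<longrightarrow> (f u, f v) \<in> parcs H}"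

definition hom_count :: "'a pair_pre_digraph \<Rightarrow> 'b pair_pre_digraph \<Rightarrow> nat" where
  "hom_count G H = card (colorings G H)"

text \<open>The constant \<^const>\<open>tree\<close> of the library concerns directed graphs: in a symmetric digraph
  every edge already yields a directed cycle \<open>a, b, a\<close>. A cycle of an undirected simple graph is a
  directed cycle with at least three arcs. The library's connected graphs are nonempty.\<close>

definition undirected_tree :: "'a pair_pre_digraph \<Rightarrow> bool" where
  "undirected_tree T \<longleftrightarrow>
     pair_graph T \<and> connected (with_proj T) \<and>
     \<not> (\<exists>p. pre_digraph.cycle (with_proj T) p \<and> 3 \<le> length p)"

text \<open>All trees with vertex set \<open>{0, \<dots>, n - 1}\<close>. Every isomorphism class of trees on \<open>n\<close> vertices
  has at least one representative in this set; isomorphic trees are not identified.\<close>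

definition trees_on :: "nat \<Rightarrow> nat pair_pre_digraph set" where
  "trees_on n = {T. undirected_tree T \<and> pverts T = {..<n}}"

definition path_graph :: "nat \<Rightarrow> nat pair_pre_digraph" where
  "path_graph n =
     \<lparr>pverts = {..<n}, parcs = {(i, j). i < n \<and> j < n \<and> (j = Suc i \<or> i = Suc j)}\<rparr>"

definition hoffman_london :: "'b pair_pre_digraph \<Rightarrow> bool" where
  "hoffman_london H \<longleftrightarrow>
     (\<forall>n\<ge>1. hom_count (path_graph n) H = Min ((\<lambda>T. hom_count T H) ` trees_on n))"

text \<open>As trees are meant up to isomorphism, \<open>T \<noteq> P\<^sub>n\<close> means that \<open>T\<close> is not isomorphic to
  \<open>P\<^sub>n\<close>.\<close>

definition strongly_hoffman_london :: "'b pair_pre_digraph \<Rightarrow> bool" where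
  "strongly_hoffman_london H \<longleftrightarrow>
     (\<forall>n\<ge>1. \<forall>T\<in>trees_on n.
        \<not> digraph_iso (with_proj T) (with_proj (path_graph n)) \<longrightarrow>
        hom_count (path_graph n) H < hom_count T H)"

text \<open>The minimum in \<^const>\<open>hoffman_london\<close> is taken over a finite set containing the value at the
  path.\<close>

lemma finite_trees_on: "finite (trees_on n)"
proof (rule finite_subset)
  show "trees_on n \<subseteq>
    (\<lambda>(V, E). \<lparr>pverts = V, parcs = E\<rparr>) ` ({{..<n}} \<times> Pow ({..<n} \<times> {..<n}))"
  proof
    fix T assume "T \<in> trees_on n"
    then have V: "pverts T = {..<n}" and "pair_graph T"
      by (auto simp: trees_on_def undirected_tree_def)
    then interpret pair_graph T by simp
    have "parcs T \<subseteq> {..<n} \<times> {..<n}"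
      using in_arcsD1 in_arcsD2 V by auto
    with V show "T \<in> (\<lambda>(V, E). \<lparr>pverts = V, parcs = E\<rparr>) `
        ({{..<n}} \<times> Pow ({..<n} \<times> {..<n}))"
      by (intro image_eqI[of _ _ "(pverts T, parcs T)"]) auto
  qed
qed simp

lemma pair_graph_path_graph: "pair_graph (path_graph n)"
proof
  show "finite (parcs (path_graph n))"
    by (rule finite_subset[of _ "{..<n} \<times> {..<n}"]) (auto simp: path_graph_def)
qed (auto simp: path_graph_def symmetric_def sym_def)

lemma connected_path_graph:
  assumes "n \<ge> 1"
  shows "connected (with_proj (path_graph n))"
proof -
  interpret pair_graph "path_graph n" by (rule pair_graph_path_graph)
  have r0: "0 \<rightarrow>\<^sup>*\<^bsub>with_proj (path_graph n)\<^esub> i" if "i < n" for i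
    using that
  proof (induction i)
    case 0
    then show ?case by (intro reachable_refl) (simp add: path_graph_def)
  next
    case (Suc i)
    have "(i, Suc i) \<in> parcs (path_graph n)"
      using Suc.prems by (simp add: path_graph_def)
    with Suc show ?case by (metis Suc_lessD reachable_adj_trans)
  qed
  have "u \<rightarrow>\<^sup>*\<^bsub>with_proj (path_graph n)\<^esub> v" if "u < n" "v < n" for u v
    using r0[OF that(1)] r0[OF that(2)] symmetric_reachable[OF sym_arcs] reachable_trans by blast
  then have "strongly_connected (with_proj (path_graph n))"
    using assms by (intro strongly_connectedI) (auto simp: path_graph_def lessThan_empty_iff)
  moreover have "mk_symmetric (with_proj (path_graph n)) = path_graph n"
    using arcs_symmetric by (auto simp: mk_symmetric_def intro!: pair_pre_digraph.equality)
  ultimately show ?thesis by (simp add: connected_def)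
qed

lemma acyclic_path_graph:
  assumes "pre_digraph.cycle (with_proj (path_graph n)) p"
  shows "length p < 3"
proof (rule ccontr)
  assume "\<not> length p < 3"
  then have len: "3 \<le> length p" by simp
  interpret pair_graph "path_graph n" by (rule pair_graph_path_graph)
  from assms obtain u where w: "set p \<subseteq> parcs (path_graph n)" "pcas u p u"
    and d: "distinct (tl (pawalk_verts u p))"
    unfolding cycle_def awalk_def by auto
  have vs: "pawalk_verts u p = u # map snd p" if "pcas u p v" for u p v
    using that by (induction p arbitrary: u) (auto simp: neq_Nil_conv)
  have step: "fst (p ! i) = (u # map snd p) ! i" if "pcas u p v" "i < length p" for u p v i
    using that by (induction p arbitrary: u i) (auto simp: nth_Cons split: nat.splits)
  have last: "(u # map snd p) ! length p = v" if "pcas u p v" for u v and p :: "(nat \<times> nat) list"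
    using that by (induction p arbitrary: u) auto
  define x where "x i = (u # map snd p) ! i" for i
  have dist: "x i \<noteq> x j" if "1 \<le> i" "i < j" "j \<le> length p" for i j
    using d that vs[OF w(2)] unfolding x_def
    by (auto simp: nth_Cons' nth_eq_iff_index_eq simp del: nth_map)
  have x0: "x 0 = x (length p)"
    using last[OF w(2)] by (simp add: x_def)
  have adj: "x (Suc i) = Suc (x i) \<or> x i = Suc (x (Suc i))" if "i < length p" for i
  proof -
    have "(fst (p ! i), snd (p ! i)) \<in> parcs (path_graph n)"
      using w(1) that nth_mem by force
    then show ?thesis
      using step[OF w(2) that] that by (auto simp: x_def path_graph_def)
  qed
  have ne: "x (Suc (Suc i)) \<noteq> x i" if "Suc (Suc i) \<le> length p" for i
  proof (cases i)
    case 0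
    then show ?thesis using dist[of "2" "length p"] x0 len by (auto simp: numeral_2_eq_2)
  next
    case (Suc j)
    then show ?thesis using dist[of i "Suc (Suc i)"] that by auto
  qed
  have up: "x (Suc i) = Suc (x i)" if "x 1 = Suc (x 0)" "i < length p" for i
    using that(2)
  proof (induction i)
    case (Suc i)
    then show ?case using adj[of "Suc i"] ne[of i] by auto
  qed (use that in simp)
  have down: "x i = Suc (x (Suc i))" if "x 0 = Suc (x 1)" "i < length p" for i
    using that(2)
  proof (induction i)
    case (Suc i)
    then show ?case using adj[of "Suc i"] ne[of i] by auto
  qed (use that in simp)
  have "x 1 = Suc (x 0) \<or> x 0 = Suc (x 1)" using adj[of 0, OF less_le_trans[OF _ len]] by simp
  then show False
  proof
    assume a: "x 1 = Suc (x 0)"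
    have s: "x i = x 0 + i" if "i \<le> length p" for i
      using that by (induction i) (auto simp: up[OF a])
    show False using s[OF order_refl] x0 len by linarith
  next
    assume a: "x 0 = Suc (x 1)"
    have s: "x 0 = x i + i" if "i \<le> length p" for i
      using that
    proof (induction i)
      case (Suc i)
      then show ?case using down[OF a, of i] by simp
    qed simp
    show False using s[OF order_refl] x0 len by linarith
  qed
qed

lemma path_graph_in_trees_on:
  assumes "n \<ge> 1"
  shows "path_graph n \<in> trees_on n"
proof -
  have "pverts (path_graph n) = {..<n}"
    by (simp add: path_graph_def)
  then show ?thesis
    unfolding trees_on_def undirected_tree_def
    using pair_graph_path_graph connected_path_graph[OF assms] acyclic_path_graph[of n]
    by (auto simp: not_le[symmetric])
qed

end

theory Submission
  imports Defs
begin

text \<open>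
  Build a rooted tree by repeatedly joining the root of a tree \<open>t\<close> by an edge to the root of a
  tree \<open>s\<close>. The number \<open>w i\<close> of colorings that send the root to \<open>i\<close> multiplies accordingly:
  \<open>w\<^sub>s i * (A w\<^sub>t) i\<close>, where \<open>A\<close> is the adjacency operator of the target path. All these vectors
  are graded: they depend only on the distance of \<open>i\<close> to the nearer end of the target and grow with
  it, because for an even path the two middle vertices are mirror images and \<open>A\<close> preserves this
  property. For graded \<open>r\<close> and \<open>x\<close>, the symmetry of the powers of \<open>A\<close> gives
  \<open>2 * (\<Sum>i. r i * x i * (A\<^sup>a 1) i - \<Sum>i. r i * (A\<^sup>a x) i) = \<Sum>i j. (A\<^sup>a)\<^sub>i\<^sub>j * (r i - r j) * (x i - x j) \<ge> 0\<close>,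
  which says that moving a branch \<open>x\<close> from one end of a hanging path of length \<open>a\<close> to its other
  end does not increase the number of colorings. Structural induction on the tree, with an
  arbitrary graded weight \<open>r\<close> at the root, straightens it to a path.
\<close>

section \<open>The adjacency operator of a path\<close>

definition step :: "nat \<Rightarrow> (nat \<Rightarrow> int) \<Rightarrow> nat \<Rightarrow> int" where
  "step N h i = (\<Sum>j | j < N \<and> (j = Suc i \<or> i = Suc j). h j)"

lemma step_cong:
  assumes "\<And>j. j < N \<Longrightarrow> h j = h' j"
  shows "step N h = step N h'"
  unfolding step_def using assms by (auto intro!: ext sum.cong)

lemma step_alt: "step N h i = (\<Sum>j<N. of_bool (j = Suc i \<or> i = Suc j) * h j)"
  unfolding step_def by (rule sum.mono_neutral_cong_left) auto

text \<open>In the tree induction this identity moves the root across an edge.\<close>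

lemma step_self_adjoint:
  "(\<Sum>i<N. r i * step N x i) = (\<Sum>i<N. step N r i * x i)"
proof -
  define c where "c i j = (of_bool (j = Suc i \<or> i = Suc j) :: int)" for i j
  have step: "step N h i = (\<Sum>j<N. c i j * h j)" for h i
    by (simp only: step_alt c_def)
  have sym: "c i j = c j i" for i j
    by (auto simp: c_def)
  have "(\<Sum>i<N. r i * step N x i) = (\<Sum>i<N. \<Sum>j<N. r i * (c i j * x j))"
    by (simp add: step sum_distrib_left)
  also have "\<dots> = (\<Sum>j<N. \<Sum>i<N. r i * (c i j * x j))"
    by (rule sum.swap)
  also have "\<dots> = (\<Sum>j<N. step N r j * x j)"
    unfolding step sum_distrib_right by (intro sum.cong refl) (simp add: sym mult_ac)
  finally show ?thesis .
qed

lemma funpow_step_self_adjoint: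
  "(\<Sum>i<N. r i * (step N ^^ a) x i) = (\<Sum>i<N. (step N ^^ a) r i * x i)"
proof (induction a arbitrary: x)
  case (Suc a)
  have "(\<Sum>i<N. r i * (step N ^^ Suc a) x i) = (\<Sum>i<N. (step N ^^ a) r i * step N x i)"
    unfolding funpow_Suc_right o_def by (rule Suc.IH)
  also have "\<dots> = (\<Sum>i<N. (step N ^^ Suc a) r i * x i)"
    by (simp add: step_self_adjoint)
  finally show ?case .
qed simp

text \<open>The entries of the \<open>a\<close>-th power of the adjacency matrix.\<close>

definition walks :: "nat \<Rightarrow> nat \<Rightarrow> nat \<Rightarrow> nat \<Rightarrow> int" where
  "walks N a i j = (step N ^^ a) (\<lambda>k. of_bool (k = j)) i"

lemma walks_0: "walks N 0 i j = of_bool (i = j)"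
  and walks_Suc: "walks N (Suc a) i j = step N (\<lambda>k. walks N a k j) i"
  by (simp_all add: walks_def)

lemma walks_nonneg: "0 \<le> walks N a i j"
  by (induction a arbitrary: i) (auto simp: walks_0 walks_Suc step_def intro!: sum_nonneg)

lemma walks_sym:
  assumes "i < N" "j < N"
  shows "walks N a i j = walks N a j i"
  using funpow_step_self_adjoint
    [where N = N and a = a and r = "\<lambda>k. of_bool (k = i)" and x = "\<lambda>k. of_bool (k = j)"] assms
  by (simp add: walks_def of_bool_def if_distrib if_distribR sum.delta cong: if_cong)

lemma funpow_step_eq_walks:
  assumes "i < N"
  shows "(step N ^^ a) x i = (\<Sum>j<N. walks N a i j * x j)"
  using assms
proof (induction a arbitrary: i)
  case 0
  then show ?case by (simp add: walks_0 of_bool_def if_distrib if_distribR sum.delta cong: if_cong)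
next
  case (Suc a)
  have "(step N ^^ Suc a) x i = step N (\<lambda>k. \<Sum>j<N. walks N a k j * x j) i"
    using step_cong[OF Suc.IH] by simp
  also have "\<dots> = (\<Sum>j<N. walks N (Suc a) i j * x j)"
    unfolding step_def walks_Suc sum_distrib_right by (rule sum.swap)
  finally show ?case .
qed

lemma walks_Suc_ge:
  assumes "k < N" "k = Suc i \<or> i = Suc k"
  shows "walks N a k j \<le> walks N (Suc a) i j"
  unfolding walks_Suc step_def
  using assms by (intro member_le_sum) (auto simp: walks_nonneg)

text \<open>A walk can bounce between \<open>0\<close> and \<open>1\<close>. The lengths are treated
  together because the next even walk from \<open>0\<close> extends the odd walk from
  \<open>1\<close>.\<close>

lemma walks_even_odd_pos:
  assumes "4 \<le> N"
  shows "0 < walks N (2 * c) 0 0 \<and> 0 < walks N (Suc (2 * c)) 1 0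
    \<and> 0 < walks N (Suc (Suc (2 * c))) 2 0"
proof (induction c)
  case 0
  have "0 < walks N 0 0 0" by (simp add: walks_0)
  then show ?case
    using walks_Suc_ge[of 0 N 1 0 0] walks_Suc_ge[of 1 N 2 "Suc 0" 0] assms by simp
next
  case (Suc c)
  have "0 < walks N (2 * Suc c) 0 0"
    using walks_Suc_ge[of 1 N 0 "Suc (2 * c)" 0] Suc assms by simp
  then show ?case
    using walks_Suc_ge[of 0 N 1 "2 * Suc c" 0] walks_Suc_ge[of 1 N 2 "Suc (2 * Suc c)" 0] assms
    by simp
qed

text \<open>The walk can end at \<open>1\<close> or at \<open>2\<close>, according to the parity of \<open>a\<close>; both have positive rank
  in the path on \<open>N\<close> vertices.\<close>

lemma walks_from_end_pos:
  assumes "4 \<le> N" "1 \<le> a"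
  shows "\<exists>j\<in>{1, 2}. 0 < walks N a 0 j"
proof -
  obtain c where "a = Suc (2 * c) \<or> a = Suc (Suc (2 * c))"
    using assms(2) by (cases a) (metis oddE evenE Suc_eq_plus1 le_numeral_extra(2) not0_implies_Suc)+
  then show ?thesis
    using walks_even_odd_pos[OF assms(1), of c] walks_sym[of 0 N 1 a] walks_sym[of 0 N 2 a] assms
    by auto
qed

section \<open>Vectors graded by the distance to the nearer end\<close>

text \<open>The distance of the vertex \<open>i\<close> of the path on \<open>2 * m\<close> vertices to the nearer end.\<close>

definition rank :: "nat \<Rightarrow> nat \<Rightarrow> nat" where
  "rank m i = min i (2 * m - Suc i)"

text \<open>Vertices of equal rank satisfy the inequality both ways, so graded vectors are invariant
  under reflection of the path. Positivity makes them closed under pointwise products.\<close>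

definition graded :: "nat \<Rightarrow> (nat \<Rightarrow> int) \<Rightarrow> bool" where
  "graded m h \<longleftrightarrow> (\<forall>i<2 * m. 0 < h i) \<and>
     (\<forall>i<2 * m. \<forall>j<2 * m. rank m i \<le> rank m j \<longrightarrow> h i \<le> h j)"

lemma graded_pos: "graded m h \<Longrightarrow> i < 2 * m \<Longrightarrow> 0 < h i"
  and graded_mono:
    "graded m h \<Longrightarrow> i < 2 * m \<Longrightarrow> j < 2 * m \<Longrightarrow> rank m i \<le> rank m j \<Longrightarrow> h i \<le> h j"
  by (auto simp: graded_def)

lemma graded_one: "graded m (\<lambda>_. 1)"
  by (simp add: graded_def)

lemma graded_mult: "graded m r \<Longrightarrow> graded m x \<Longrightarrow> graded m (\<lambda>i. r i * x i)"
  unfolding graded_def by (intro conjI allI impI mult_pos_pos mult_mono) (auto intro: less_imp_le)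

lemma graded_eq:
  assumes "graded m h" "i < 2 * m" "j < 2 * m" "rank m i = rank m j"
  shows "h i = h j"
  using assms graded_mono[of m h i j] graded_mono[of m h j i] by simp

text \<open>Folding the path at its middle leaves a path on the ranks \<open>0\<close> to
  \<open>m - 1\<close>; the edge between the two middle vertices becomes a loop at
  \<open>m - 1\<close>, recorded by the \<open>min\<close>.\<close>

lemma step_graded:
  assumes h: "graded m h" and i: "i < 2 * m"
  shows "step (2 * m) h i =
    (if rank m i = 0 then 0 else h (rank m i - 1)) + h (min (Suc (rank m i)) (m - 1))"
proof -
  have N: "{j. j < 2 * m \<and> (j = Suc i \<or> i = Suc j)} =
      (if i = 0 then {} else {i - 1}) \<union> (if Suc i < 2 * m then {Suc i} else {})"
    using i by auto
  have s: "step (2 * m) h i =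
      (if i = 0 then 0 else h (i - 1)) + (if Suc i < 2 * m then h (Suc i) else 0)"
    unfolding step_def N using i by auto
  \<comment> \<open>Mirror images have indices summing to \<open>2 * m - 1\<close>, hence equal
    ranks.\<close>
  have e: "h k = h l" if "k < 2 * m" "l < 2 * m" "k = l \<or> k + l = 2 * m - 1" for k l
    using that by (intro graded_eq[OF h]) (auto simp: rank_def)
  show ?thesis
  proof (cases "i < m")
    case True
    then have r: "rank m i = i" by (auto simp: rank_def)
    have "h (Suc i) = h (min (Suc i) (m - 1))"
      using True by (intro e) auto
    then show ?thesis using True unfolding s r by auto
  next
    case False
    then have r: "rank m i = 2 * m - Suc i" by (auto simp: rank_def)
    have "h (i - 1) = h (min (Suc (2 * m - Suc i)) (m - 1))"
      using False i by (intro e) auto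
    moreover have "h (Suc i) = h (2 * m - Suc i - 1)" if "Suc i < 2 * m"
      using False that by (intro e) auto
    ultimately show ?thesis using False i unfolding s r by auto
  qed
qed

lemma rank_less: "i < 2 * m \<Longrightarrow> rank m i < m"
  and rank_id: "i < m \<Longrightarrow> rank m i = i"
  by (auto simp: rank_def)

text \<open>Both summands of the folded formula grow with the rank: truncation at
  \<open>m - 1\<close> is monotone, and the missing neighbour of an end counts as \<open>0\<close>,
  below any positive value.\<close>

lemma graded_step:
  assumes h: "graded m h"
  shows "graded m (step (2 * m) h)"
  unfolding graded_def
proof (intro conjI allI impI)
  fix i assume i: "i < 2 * m"
  have "0 < h (min (Suc (rank m i)) (m - 1))"
    using i by (intro graded_pos[OF h]) auto
  moreover have "0 < h (rank m i - 1)"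
    using rank_less[OF i] by (intro graded_pos[OF h]) auto
  ultimately show "0 < step (2 * m) h i"
    by (auto simp: step_graded[OF h i])
next
  fix i j assume i: "i < 2 * m" and j: "j < 2 * m" and le: "rank m i \<le> rank m j"
  have "h (min (Suc (rank m i)) (m - 1)) \<le> h (min (Suc (rank m j)) (m - 1))"
    using i le by (intro graded_mono[OF h]) (auto simp: rank_id)
  moreover have "0 < h (rank m j - 1)"
    using rank_less[OF j] by (intro graded_pos[OF h]) auto
  moreover have "h (rank m i - 1) \<le> h (rank m j - 1)"
    using rank_less[OF i] rank_less[OF j] le by (intro graded_mono[OF h]) (auto simp: rank_id)
  ultimately show "step (2 * m) h i \<le> step (2 * m) h j"
    using le by (auto simp: step_graded[OF h i] step_graded[OF h j])
qed

lemma graded_funpow_step: "graded m h \<Longrightarrow> graded m ((step (2 * m) ^^ a) h)"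
  by (induction a) (auto simp: graded_step)

text \<open>Vertex \<open>0\<close> sees only \<open>1\<close>, whereas \<open>1\<close> sees
  \<open>0\<close> and a vertex of rank at least its own; \<open>h 0 > 0\<close> makes the gap. For
  \<open>m = 1\<close> the two vertices have equal rank.\<close>

lemma step_strict_at_end:
  assumes h: "graded m h" and m: "2 \<le> m"
  shows "step (2 * m) h 0 < step (2 * m) h 1"
proof -
  have "h 1 \<le> h (min 2 (m - 1))"
    using m by (intro graded_mono[OF h]) (auto simp: rank_id)
  moreover have "0 < h 0"
    using m by (intro graded_pos[OF h]) auto
  moreover have "rank m 0 = 0" "rank m 1 = 1" "min (Suc 0) (m - 1) = 1"
    using m by (auto simp: rank_def)
  ultimately show ?thesis
    using step_graded[OF h, of 0] step_graded[OF h, of 1] m by (simp add: numeral_2_eq_2)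
qed

lemma mult_strict_at_end:
  assumes "graded m r" "graded m x" "2 \<le> m" "r 0 < r 1 \<or> x 0 < x 1"
  shows "r 0 * x 0 < r 1 * x (1 :: nat)"
proof -
  have "0 < r 0" "0 < r 1" "0 < x 0" "0 < x 1" "r 0 \<le> r 1" "x 0 \<le> x 1"
    using assms by (auto intro!: graded_pos graded_mono simp: rank_def)
  then show ?thesis
    using assms(4) by (auto intro: mult_strict_mono mult_less_le_imp_less mult_le_less_imp_less)
qed

section \<open>Chebyshev-type rearrangement for graded vectors\<close>

lemma rearrangement_eq:
  fixes r x :: "nat \<Rightarrow> int"
  shows "2 * ((\<Sum>i<N. r i * x i * (step N ^^ a) (\<lambda>_. 1) i) - (\<Sum>i<N. r i * (step N ^^ a) x i)) =
    (\<Sum>i<N. \<Sum>j<N. walks N a i j * ((r i - r j) * (x i - x j)))"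
proof -
  let ?D = "\<Sum>i<N. \<Sum>j<N. walks N a i j * (r i * x i)"
  let ?M = "\<Sum>i<N. \<Sum>j<N. walks N a i j * (r i * x j)"
  \<comment> \<open>\<open>(step N ^^ a) (\<lambda>_. 1)\<close> consists of the row sums of the
    matrix power.\<close>
  have D: "(\<Sum>i<N. r i * x i * (step N ^^ a) (\<lambda>_. 1) i) = ?D"
    by (intro sum.cong refl) (simp add: funpow_step_eq_walks sum_distrib_left mult_ac)
  have M: "(\<Sum>i<N. r i * (step N ^^ a) x i) = ?M"
    by (intro sum.cong refl) (simp add: funpow_step_eq_walks sum_distrib_left mult_ac)
  have D': "(\<Sum>i<N. \<Sum>j<N. walks N a i j * (r j * x j)) = ?D"
    by (subst sum.swap) (auto intro!: sum.cong simp: walks_sym)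
  have M': "(\<Sum>i<N. \<Sum>j<N. walks N a i j * (r j * x i)) = ?M"
    by (subst sum.swap) (auto intro!: sum.cong simp: walks_sym)
  have "(\<Sum>i<N. \<Sum>j<N. walks N a i j * ((r i - r j) * (x i - x j))) =
      ?D - ?M - (\<Sum>i<N. \<Sum>j<N. walks N a i j * (r j * x i))
      + (\<Sum>i<N. \<Sum>j<N. walks N a i j * (r j * x j))"
    by (simp add: algebra_simps sum.distrib sum_subtractf)
  then show ?thesis unfolding D M D' M' by simp
qed

lemma graded_rearrangement_term_nonneg:
  assumes "graded m r" "graded m x" "i < 2 * m" "j < 2 * m"
  shows "0 \<le> walks (2 * m) a i j * ((r i - r j) * (x i - x j))"
proof (cases "rank m i \<le> rank m j")
  case True
  then have "r i \<le> r j" "x i \<le> x j" using assms graded_mono by blast+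
  then show ?thesis by (intro mult_nonneg_nonneg walks_nonneg mult_nonpos_nonpos) auto
next
  case False
  then have "r j \<le> r i" "x j \<le> x i" using assms graded_mono[of m _ j i] by auto
  then show ?thesis by (intro mult_nonneg_nonneg walks_nonneg) auto
qed

lemma graded_rearrangement:
  assumes "graded m r" "graded m x"
  shows "(\<Sum>i<2 * m. r i * (step (2 * m) ^^ a) x i) \<le>
    (\<Sum>i<2 * m. r i * x i * (step (2 * m) ^^ a) (\<lambda>_. 1) i)"
proof -
  have "0 \<le> (\<Sum>i<2 * m. \<Sum>j<2 * m. walks (2 * m) a i j * ((r i - r j) * (x i - x j)))"
    by (intro sum_nonneg graded_rearrangement_term_nonneg[OF assms]) auto
  then show ?thesis unfolding rearrangement_eq[symmetric] by simp
qed

text \<open>One positive term of the nonnegative double sum suffices: a walk of length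
  \<open>a\<close> joins the end \<open>0\<close> to a vertex of rank at least that of
  \<open>1\<close>, where both vectors are strictly larger.\<close>

lemma graded_rearrangement_strict:
  assumes r: "graded m r" and x: "graded m x"
    and m: "2 \<le> m" and a: "1 \<le> a" and r01: "r 0 < r 1" and x01: "x 0 < x 1"
  shows "(\<Sum>i<2 * m. r i * (step (2 * m) ^^ a) x i) <
    (\<Sum>i<2 * m. r i * x i * (step (2 * m) ^^ a) (\<lambda>_. 1) i)"
proof -
  let ?t = "\<lambda>i j. walks (2 * m) a i j * ((r i - r j) * (x i - x j))"
  obtain j where j: "j \<in> {1, 2}" "0 < walks (2 * m) a 0 j"
    using walks_from_end_pos[of "2 * m" a] m a by auto
  have "rank m 1 \<le> rank m j" "j < 2 * m"
    using j(1) m by (auto simp: rank_def)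
  then have "r 0 < r j" "x 0 < x j"
    using r01 x01 graded_mono[OF r, of 1 j] graded_mono[OF x, of 1 j] m by auto
  then have "0 < ?t 0 j"
    using j(2) by (intro mult_pos_pos mult_neg_neg) auto
  also have "?t 0 j \<le> (\<Sum>j<2 * m. ?t 0 j)"
    using \<open>j < 2 * m\<close> by (intro member_le_sum graded_rearrangement_term_nonneg[OF r x]) auto
  also have "\<dots> \<le> (\<Sum>i<2 * m. \<Sum>j<2 * m. ?t i j)"
    using m by (intro member_le_sum[of 0 _ "\<lambda>i. \<Sum>j<2 * m. ?t i j"] sum_nonneg
        graded_rearrangement_term_nonneg[OF r x]) auto
  finally show ?thesis unfolding rearrangement_eq[symmetric] by simp
qed

section \<open>Rooted trees and their weights\<close>

text \<open>A binary constructor replaces lists of children: cutting one edge at the root splits off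
  the branch \<open>t\<close> and leaves \<open>s\<close> with the old root.\<close>

datatype 'a rtree = Vertex 'a | Graft "'a rtree" "'a rtree"

primrec rt_size :: "'a rtree \<Rightarrow> nat" where
  "rt_size (Vertex v) = 1"
| "rt_size (Graft s t) = rt_size s + rt_size t"

primrec weight :: "nat \<Rightarrow> 'a rtree \<Rightarrow> nat \<Rightarrow> int" where
  "weight N (Vertex v) = (\<lambda>_. 1)"
| "weight N (Graft s t) = (\<lambda>i. weight N s i * step N (weight N t) i)"

text \<open>In \<open>end_path\<close> the root is an end of the path; in \<open>path_like\<close> it may be any vertex.\<close>

primrec end_path :: "'a rtree \<Rightarrow> bool" where
  "end_path (Vertex v) \<longleftrightarrow> True"
| "end_path (Graft s t) \<longleftrightarrow> (\<exists>v. s = Vertex v) \<and> end_path t"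

primrec path_like :: "'a rtree \<Rightarrow> bool" where
  "path_like (Vertex v) \<longleftrightarrow> True"
| "path_like (Graft s t) \<longleftrightarrow> end_path s \<and> end_path t"

lemma rt_size_pos: "0 < rt_size t"
  by (induction t) auto

lemma weight_end_path: "end_path t \<Longrightarrow> weight N t = (step N ^^ (rt_size t - 1)) (\<lambda>_. 1)"
proof (induction t)
  case (Graft s t)
  then show ?case using rt_size_pos[of t] by (cases "rt_size t") auto
qed simp

lemma graded_weight: "graded m (weight (2 * m) t)"
  by (induction t) (auto simp: graded_one graded_mult graded_step)

section \<open>Straightening rooted trees to paths\<close>

lemma sum_weight_ge:
  assumes "graded m r"
  shows "(\<Sum>i<2 * m. r i * (step (2 * m) ^^ (rt_size t - 1)) (\<lambda>_. 1) i) \<le>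
    (\<Sum>i<2 * m. r i * weight (2 * m) t i)"
  using assms
proof (induction t arbitrary: r)
  case (Graft s t)
  let ?A = "step (2 * m)"
  obtain a b where a: "rt_size s = Suc a" and b: "rt_size t = Suc b"
    by (meson rt_size_pos gr0_conv_Suc)
  \<comment> \<open>The factor that the branch \<open>t\<close> would contribute at its point of
    attachment if it were a path; the exponent includes the attaching edge.\<close>
  let ?y = "(?A ^^ Suc b) (\<lambda>_. 1)"
  have y: "graded m ?y" by (intro graded_funpow_step graded_one)
  have rs: "graded m (\<lambda>i. r i * weight (2 * m) s i)" (is "graded m ?rs")
    by (intro graded_mult Graft.prems graded_weight)
  have "(\<Sum>i<2 * m. r i * (?A ^^ (rt_size (Graft s t) - 1)) (\<lambda>_. 1) i) =
      (\<Sum>i<2 * m. r i * (?A ^^ a) ?y i)"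
    by (simp add: a b funpow_add flip: funpow.simps add_Suc_right)
  \<comment> \<open>Moving \<open>?y\<close> from the far end of a path of \<open>a\<close> edges to
    the root does not decrease the sum. There it joins the root weight, and induction replaces the
    path by \<open>s\<close>.\<close>
  also have "\<dots> \<le> (\<Sum>i<2 * m. (r i * ?y i) * (?A ^^ (rt_size s - 1)) (\<lambda>_. 1) i)"
    using graded_rearrangement[OF Graft.prems y] by (simp add: a)
  also have "\<dots> \<le> (\<Sum>i<2 * m. (r i * ?y i) * weight (2 * m) s i)"
    by (intro Graft.IH(1) graded_mult Graft.prems y)
  \<comment> \<open>The root is shifted to that of \<open>t\<close>, with \<open>r\<close> and
    \<open>s\<close> absorbed into its weight, so that induction applies to
    \<open>t\<close>.\<close>
  also have "\<dots> = (\<Sum>i<2 * m. ?A ?rs i * (?A ^^ (rt_size t - 1)) (\<lambda>_. 1) i)"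
    unfolding step_self_adjoint[symmetric] by (simp add: b mult_ac)
  also have "\<dots> \<le> (\<Sum>i<2 * m. ?A ?rs i * weight (2 * m) t i)"
    by (intro Graft.IH(2) graded_step rs)
  also have "\<dots> = (\<Sum>i<2 * m. r i * weight (2 * m) (Graft s t) i)"
    unfolding step_self_adjoint[symmetric] by (simp add: mult_ac)
  finally show ?case .
qed simp

text \<open>With constant \<open>r\<close> a path gives equality wherever it is rooted, hence the
  last assumption. The root weights passed down in the induction, \<open>?ry\<close> and
  \<open>?A ?rs\<close>, are always strict at the end.\<close>

lemma sum_weight_gr:
  assumes "graded m r" "2 \<le> m" "\<not> end_path t" "r 0 < r 1 \<or> \<not> path_like t"
  shows "(\<Sum>i<2 * m. r i * (step (2 * m) ^^ (rt_size t - 1)) (\<lambda>_. 1) i) <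
    (\<Sum>i<2 * m. r i * weight (2 * m) t i)"
  using assms
proof (induction t arbitrary: r)
  case (Graft s t)
  let ?A = "step (2 * m)"
  obtain a b where a: "rt_size s = Suc a" and b: "rt_size t = Suc b"
    by (meson rt_size_pos gr0_conv_Suc)
  let ?y = "(?A ^^ Suc b) (\<lambda>_. 1)"
  have y: "graded m ?y" by (intro graded_funpow_step graded_one)
  have y01: "?y 0 < ?y 1"
    unfolding funpow.simps o_def
    by (intro step_strict_at_end graded_funpow_step graded_one Graft.prems)
  have ry: "graded m (\<lambda>i. r i * ?y i)" (is "graded m ?ry") by (intro graded_mult Graft.prems y)
  have ry01: "?ry 0 < ?ry 1"
    using mult_strict_at_end[OF Graft.prems(1) y Graft.prems(2)] y01 by blast
  have rs: "graded m (\<lambda>i. r i * weight (2 * m) s i)" (is "graded m ?rs")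
    by (intro graded_mult Graft.prems graded_weight)
  let ?S0 = "\<Sum>i<2 * m. r i * (?A ^^ a) ?y i"
  let ?S1 = "\<Sum>i<2 * m. ?ry i * (?A ^^ (rt_size s - 1)) (\<lambda>_. 1) i"
  let ?S2 = "\<Sum>i<2 * m. ?ry i * weight (2 * m) s i"
  let ?S3 = "\<Sum>i<2 * m. ?A ?rs i * weight (2 * m) t i"
  have S0: "(\<Sum>i<2 * m. r i * (?A ^^ (rt_size (Graft s t) - 1)) (\<lambda>_. 1) i) = ?S0"
    by (simp add: a b funpow_add flip: funpow.simps add_Suc_right)
  have S2: "?S2 = (\<Sum>i<2 * m. ?A ?rs i * (?A ^^ (rt_size t - 1)) (\<lambda>_. 1) i)"
    unfolding step_self_adjoint[symmetric] by (simp add: b mult_ac)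
  have S3: "?S3 = (\<Sum>i<2 * m. r i * weight (2 * m) (Graft s t) i)"
    unfolding step_self_adjoint[symmetric] by (simp add: mult_ac)
  have S01: "?S0 \<le> ?S1"
    using graded_rearrangement[OF Graft.prems(1) y] by (simp add: a)
  have S12: "?S1 \<le> ?S2" by (rule sum_weight_ge[OF ry])
  have S23: "?S2 \<le> ?S3" unfolding S2 by (intro sum_weight_ge graded_step rs)
  \<comment> \<open>Each case makes another link of the chain strict: restoring \<open>t\<close>,
    restoring \<open>s\<close>, or moving the branch.\<close>
  consider "\<not> end_path t" | "\<not> end_path s" | "end_path s" "end_path t" by blast
  then have "?S0 < ?S3"
  proof cases
    case 1
    have "?A ?rs 0 < ?A ?rs 1" by (intro step_strict_at_end rs Graft.prems)
    then have "?S2 < ?S3"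
      unfolding S2 using 1 by (intro Graft.IH(2) graded_step rs Graft.prems) auto
    then show ?thesis using S01 S12 by linarith
  next
    case 2
    then have "?S1 < ?S2" using ry01 by (intro Graft.IH(1) ry Graft.prems) auto
    then show ?thesis using S01 S23 by linarith
  next
    case 3
    with Graft.prems have r01: "r 0 < r 1" and ns: "\<nexists>v. s = Vertex v" by auto
    \<comment> \<open>The move is strict only along at least one edge, which exists since
      \<open>s\<close> is not a single vertex.\<close>
    have "1 \<le> a"
    proof (cases s)
      case (Graft s1 s2)
      then show ?thesis using a rt_size_pos[of s1] rt_size_pos[of s2] by auto
    qed (use ns in auto)
    then have "?S0 < ?S1"
      using graded_rearrangement_strict[OF Graft.prems(1) y Graft.prems(2) _ r01 y01]
      by (simp add: a)
    then show ?thesis using S12 S23 by linarith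
  qed
  then show ?case unfolding S0 S3 .
qed simp

section \<open>Rooted trees as graphs\<close>

primrec rt_root :: "'a rtree \<Rightarrow> 'a" where
  "rt_root (Vertex v) = v"
| "rt_root (Graft s t) = rt_root s"

primrec rt_verts :: "'a rtree \<Rightarrow> 'a set" where
  "rt_verts (Vertex v) = {v}"
| "rt_verts (Graft s t) = rt_verts s \<union> rt_verts t"

primrec rt_arcs :: "'a rtree \<Rightarrow> ('a \<times> 'a) set" where
  "rt_arcs (Vertex v) = {}"
| "rt_arcs (Graft s t) =
     rt_arcs s \<union> rt_arcs t \<union> {(rt_root s, rt_root t), (rt_root t, rt_root s)}"

primrec rt_distinct :: "'a rtree \<Rightarrow> bool" where
  "rt_distinct (Vertex v) \<longleftrightarrow> True"
| "rt_distinct (Graft s t) \<longleftrightarrow> rt_distinct s \<and> rt_distinct t \<and> rt_verts s \<inter> rt_verts t = {}"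

definition rt_graph :: "'a rtree \<Rightarrow> 'a pair_pre_digraph" where
  "rt_graph t = \<lparr>pverts = rt_verts t, parcs = rt_arcs t\<rparr>"

lemma rt_graph_simps [simp]: "pverts (rt_graph t) = rt_verts t" "parcs (rt_graph t) = rt_arcs t"
  by (simp_all add: rt_graph_def)

lemma rt_root_in_verts [simp]: "rt_root t \<in> rt_verts t"
  by (induction t) auto

lemma finite_rt_verts [simp]: "finite (rt_verts t)"
  by (induction t) auto

lemma card_rt_verts: "rt_distinct t \<Longrightarrow> card (rt_verts t) = rt_size t"
  by (induction t) (auto simp: card_Un_disjoint)

lemma rt_arcs_subset: "rt_arcs t \<subseteq> rt_verts t \<times> rt_verts t"
  by (induction t) auto

lemma rt_arcs_sym: "(u, v) \<in> rt_arcs t \<Longrightarrow> (v, u) \<in> rt_arcs t"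
  by (induction t) auto

lemma rt_root_reaches: "u \<in> rt_verts t \<Longrightarrow> (rt_root t, u) \<in> (rt_arcs t)\<^sup>*"
proof (induction t)
  case (Graft s t)
  let ?E = "rt_arcs (Graft s t)"
  have s: "(rt_arcs s)\<^sup>* \<subseteq> ?E\<^sup>*" and t: "(rt_arcs t)\<^sup>* \<subseteq> ?E\<^sup>*"
    by (auto intro!: rtrancl_mono)
  have st: "(rt_root s, rt_root t) \<in> ?E" by simp
  show ?case
  proof (cases "u \<in> rt_verts s")
    case True
    then show ?thesis using Graft.IH(1) s by auto
  next
    case False
    then have "(rt_root t, u) \<in> ?E\<^sup>*" using Graft.IH(2) Graft.prems t by auto
    then show ?thesis using converse_rtrancl_into_rtrancl[OF st] by simp
  qed
qed simp

lemma rt_reaches: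
  assumes "u \<in> rt_verts t" "v \<in> rt_verts t"
  shows "(u, v) \<in> (rt_arcs t)\<^sup>*"
proof -
  have "sym ((rt_arcs t)\<^sup>*)"
    by (intro sym_rtrancl) (auto simp: sym_def intro: rt_arcs_sym)
  then show ?thesis
    using symD[OF _ rt_root_reaches[OF assms(1)]] rt_root_reaches[OF assms(2)]
    by (blast intro: rtrancl_trans)
qed

section \<open>Every tree arises from a rooted tree\<close>

primrec add_leaf :: "'a \<Rightarrow> 'a \<Rightarrow> 'a rtree \<Rightarrow> 'a rtree" where
  "add_leaf u v (Vertex w) = Graft (Vertex w) (Vertex v)"
| "add_leaf u v (Graft s t) =
     (if u \<in> rt_verts s then Graft (add_leaf u v s) t else Graft s (add_leaf u v t))"

lemma rt_root_add_leaf [simp]: "rt_root (add_leaf u v t) = rt_root t"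
  by (induction t) auto

lemma rt_verts_add_leaf [simp]: "rt_verts (add_leaf u v t) = insert v (rt_verts t)"
  by (induction t) auto

text \<open>The recursion descends towards \<open>u\<close>, so the single vertex it reaches is
  \<open>u\<close> itself, although the base case of \<open>add_leaf\<close> does not compare the
  two.\<close>

lemma rt_arcs_add_leaf:
  "u \<in> rt_verts t \<Longrightarrow> rt_arcs (add_leaf u v t) = rt_arcs t \<union> {(u, v), (v, u)}"
proof (induction t)
  case (Graft s t)
  then show ?case by (cases "u \<in> rt_verts s") (simp_all add: Un_ac insert_commute)
qed simp

lemma rt_distinct_add_leaf:
  "rt_distinct t \<Longrightarrow> u \<in> rt_verts t \<Longrightarrow> v \<notin> rt_verts t \<Longrightarrow> rt_distinct (add_leaf u v t)"
  by (induction t) auto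

lemma pair_wf_digraph_rt_graph: "pair_wf_digraph (rt_graph t)"
  using rt_arcs_subset[of t] by unfold_locales auto

text \<open>Otherwise \<open>S\<close> would be closed under arcs and contain everything reachable
  from it, against connectedness.\<close>

lemma undirected_tree_arc_leaving:
  assumes "undirected_tree T" "S \<subset> pverts T" "S \<noteq> {}"
  shows "\<exists>u\<in>S. \<exists>v\<in>pverts T - S. (u, v) \<in> parcs T"
proof (rule ccontr)
  assume none: "\<not> ?thesis"
  interpret pair_graph T using assms(1) by (simp add: undirected_tree_def)
  \<comment> \<open>Connectedness refers to the symmetric closure, here the graph itself.\<close>
  have "mk_symmetric (with_proj T) = T"
    using arcs_symmetric by (auto simp: mk_symmetric_def intro!: pair_pre_digraph.equality)
  then have conn: "u \<rightarrow>\<^sup>*\<^bsub>with_proj T\<^esub> v" if "u \<in> pverts T" "v \<in> pverts T" for u v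
    using assms(1) that by (auto simp: undirected_tree_def connected_def strongly_connected_def)
  obtain u v where u: "u \<in> S" and v: "v \<in> pverts T - S" using assms(2,3) by blast
  have "u \<rightarrow>\<^sup>*\<^bsub>with_proj T\<^esub> v" using conn u v assms(2) by blast
  then have "v \<in> S"
  proof (induction rule: reachable_induct)
    case (step x y)
    then show ?case using none in_arcsD2 by auto
  qed (rule u)
  then show False using v by simp
qed

text \<open>Leaves are added one at a time along arcs leaving the current vertex set.\<close>

lemma exists_spanning_rtree:
  assumes "undirected_tree T"
  shows "\<exists>t. rt_distinct t \<and> rt_verts t = pverts T \<and> rt_arcs t \<subseteq> parcs T"
proof -
  interpret pair_graph T using assms by (simp add: undirected_tree_def)
  have "\<exists>t. rt_distinct t \<and> rt_verts t \<subseteq> pverts T \<and> rt_arcs t \<subseteq> parcs T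
      \<and> card (rt_verts t) = Suc k" if "Suc k \<le> card (pverts T)" for k
    using that
  proof (induction k)
    case 0
    then obtain v where "v \<in> pverts T" by (metis card.empty ex_in_conv not_one_le_zero One_nat_def)
    then show ?case by (intro exI[of _ "Vertex v"]) simp
  next
    case (Suc k)
    then obtain t where t: "rt_distinct t" "rt_verts t \<subseteq> pverts T" "rt_arcs t \<subseteq> parcs T"
        "card (rt_verts t) = Suc k"
      by auto
    then have "rt_verts t \<subset> pverts T" using Suc.prems by auto
    moreover have "rt_verts t \<noteq> {}" using rt_root_in_verts by blast
    ultimately obtain u v where uv: "u \<in> rt_verts t" "v \<in> pverts T - rt_verts t" "(u, v) \<in> parcs T"
      using undirected_tree_arc_leaving[OF assms] by blast
    then show ?case
      using t uv arcs_symmetric[OF uv(3)]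
      by (intro exI[of _ "add_leaf u v t"]) (auto simp: rt_arcs_add_leaf rt_distinct_add_leaf)
  qed
  moreover have "pverts T \<noteq> {}"
    using assms by (auto simp: undirected_tree_def connected_def strongly_connected_def mk_symmetric_def)
  then have "Suc (card (pverts T) - 1) = card (pverts T)"
    by (simp add: card_gt_0_iff)
  ultimately obtain t where "rt_distinct t" "rt_verts t \<subseteq> pverts T" "rt_arcs t \<subseteq> parcs T"
      "card (rt_verts t) = card (pverts T)"
    by (metis order_refl)
  then show ?thesis using card_subset_eq pair_finite_verts by blast
qed

text \<open>Acyclicity enters here: an arc outside the spanning tree would close a cycle with the
  tree path between its ends.\<close>

lemma undirected_tree_eq_rt_graph:
  assumes "undirected_tree T"
  obtains t where "rt_distinct t" "T = rt_graph t"
proof -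
  interpret T: pair_graph T using assms by (simp add: undirected_tree_def)
  obtain t where t: "rt_distinct t" "rt_verts t = pverts T" "rt_arcs t \<subseteq> parcs T"
    using exists_spanning_rtree[OF assms] by blast
  interpret R: pair_wf_digraph "rt_graph t" by (rule pair_wf_digraph_rt_graph)
  have "(w, u) \<in> rt_arcs t" if wu: "(w, u) \<in> parcs T" for w u
  proof (rule ccontr)
    assume n: "(w, u) \<notin> rt_arcs t"
    have w: "w \<in> rt_verts t" and u: "u \<in> rt_verts t"
      using wu T.in_arcsD1 T.in_arcsD2 t(2) by auto
    have "u \<rightarrow>\<^sup>*\<^bsub>with_proj (rt_graph t)\<^esub> w"
      using rt_reaches[OF u w]
    proof (induction rule: rtrancl_induct)
      case base
      then show ?case using u by (intro R.reachable_refl) simp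
    next
      case (step y z)
      then show ?case using R.reachable_adj_trans by simp
    qed
    then obtain p where p: "R.apath u p w" using R.reachable_apath by blast
    \<comment> \<open>The cycle needs three arcs: \<open>p\<close> is nonempty as there are no
      loops, and a single arc would be the reverse of \<open>(w, u)\<close>, putting
      \<open>(w, u)\<close> into the tree.\<close>
    have "p \<noteq> []" using p T.no_loops'[OF wu] by (auto simp: R.apath_Nil_iff)
    moreover have "p \<noteq> [e]" for e
      using p n rt_arcs_sym[of u w t] by (cases e) (auto simp: R.apath_def R.awalk_def)
    ultimately have len: "3 \<le> length ((w, u) # p)"
      by (cases p rule: remdups_adj.cases) auto
    have "T.cycle ((w, u) # p)"
      unfolding T.cycle_def T.awalk_def
      using p wu t w by (intro exI[of _ w]) (auto simp: R.apath_def R.awalk_def)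
    then show False using assms len by (auto simp: undirected_tree_def)
  qed
  then have "rt_arcs t = parcs T" using t(3) by auto
  then have "T = rt_graph t" using t(2) by (auto intro!: pair_pre_digraph.equality)
  then show thesis using t(1) that by blast
qed

section \<open>Counting colorings\<close>

definition rooted_colorings :: "nat \<Rightarrow> 'a rtree \<Rightarrow> nat \<Rightarrow> ('a \<Rightarrow> nat) set" where
  "rooted_colorings N t i = {f \<in> colorings (rt_graph t) (path_graph N). f (rt_root t) = i}"

lemma rooted_colorings_iff:
  "f \<in> rooted_colorings N t i \<longleftrightarrow> f \<in> rt_verts t \<rightarrow>\<^sub>E {..<N}
    \<and> (\<forall>u v. (u, v) \<in> rt_arcs t \<longrightarrow> (f u, f v) \<in> parcs (path_graph N)) \<and> f (rt_root t) = i"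
  by (auto simp: rooted_colorings_def colorings_def path_graph_def)

lemma finite_rooted_colorings: "finite (rooted_colorings N t i)"
  by (rule finite_subset[of _ "rt_verts t \<rightarrow>\<^sub>E {..<N}"])
    (auto simp: rooted_colorings_iff intro: finite_PiE)

lemma restrict_rooted_coloring:
  assumes "f \<in> rt_verts t' \<rightarrow>\<^sub>E {..<N}" "\<forall>u v. (u, v) \<in> rt_arcs t' \<longrightarrow> (f u, f v) \<in> parcs (path_graph N)"
    and "rt_verts t \<subseteq> rt_verts t'" "rt_arcs t \<subseteq> rt_arcs t'"
  shows "restrict f (rt_verts t) \<in> rooted_colorings N t (f (rt_root t))"
  using assms rt_arcs_subset[of t] by (auto simp: rooted_colorings_iff PiE_iff subset_iff)

lemma rooted_colorings_cong:
  assumes "\<And>u. u \<in> rt_verts t \<Longrightarrow> f u = g u" "g \<in> rooted_colorings N t i"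
  shows "f (rt_root t) = i" "(u, v) \<in> rt_arcs t \<Longrightarrow> (f u, f v) \<in> parcs (path_graph N)"
    "u \<in> rt_verts t \<Longrightarrow> f u < N"
  using assms rt_arcs_subset[of t] by (auto simp: rooted_colorings_iff subset_iff)

text \<open>The two restrictions are independent except along the attaching edge, which sends the
  root of \<open>t\<close> to a neighbour of \<open>i\<close>.\<close>

lemma bij_betw_rooted_colorings_Graft:
  assumes "rt_verts s \<inter> rt_verts t = {}" "i < N"
  shows "bij_betw (\<lambda>f. (restrict f (rt_verts s), restrict f (rt_verts t)))
    (rooted_colorings N (Graft s t) i)
    (rooted_colorings N s i \<times> (\<Union>j\<in>{j. j < N \<and> (j = Suc i \<or> i = Suc j)}. rooted_colorings N t j))"
    (is "bij_betw ?F ?A ?B")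
proof (rule bij_betw_byWitness)
  \<comment> \<open>Outside both vertex sets the glued map takes the value of \<open>h\<close>,
    which is \<open>undefined\<close> there, so it stays extensional.\<close>
  let ?G = "\<lambda>(g, h) x. if x \<in> rt_verts s then g x else h x"
  show "\<forall>f\<in>?A. ?G (?F f) = f"
    by (auto simp: rooted_colorings_iff PiE_iff extensional_def fun_eq_iff)
  show "\<forall>p\<in>?B. ?F (?G p) = p"
    using assms(1) by (auto simp: rooted_colorings_iff PiE_iff extensional_def fun_eq_iff)
  show "?F ` ?A \<subseteq> ?B"
  proof
    fix p assume "p \<in> ?F ` ?A"
    then obtain f where f: "f \<in> ?A" and p: "p = ?F f" by blast
    have fE: "f \<in> rt_verts (Graft s t) \<rightarrow>\<^sub>E {..<N}"
      "\<forall>u v. (u, v) \<in> rt_arcs (Graft s t) \<longrightarrow> (f u, f v) \<in> parcs (path_graph N)"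
      and i: "f (rt_root s) = i"
      using f by (auto simp: rooted_colorings_iff)
    have "(f (rt_root s), f (rt_root t)) \<in> parcs (path_graph N)" using fE(2) by simp
    then have "f (rt_root t) \<in> {j. j < N \<and> (j = Suc i \<or> i = Suc j)}"
      using i by (auto simp: path_graph_def)
    moreover have "restrict f (rt_verts t) \<in> rooted_colorings N t (f (rt_root t))"
      by (rule restrict_rooted_coloring[OF fE]) auto
    moreover have "restrict f (rt_verts s) \<in> rooted_colorings N s i"
      using restrict_rooted_coloring[OF fE, of s] i by auto
    ultimately show "p \<in> ?B" using p by blast
  qed
  show "?G ` ?B \<subseteq> ?A"
  proof
    fix f assume "f \<in> ?G ` ?B"
    then obtain g h j where g: "g \<in> rooted_colorings N s i" and h: "h \<in> rooted_colorings N t j"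
      and j: "j < N" "j = Suc i \<or> i = Suc j" and f: "f = ?G (g, h)"
      by blast
    have fs: "f u = g u" if "u \<in> rt_verts s" for u using that f by simp
    have ft: "f u = h u" if "u \<in> rt_verts t" for u using that f assms(1) by auto
    note S = rooted_colorings_cong[OF fs g] and T = rooted_colorings_cong[OF ft h]
    have "f x = undefined" if "x \<notin> rt_verts s" "x \<notin> rt_verts t" for x
      using that f h by (auto simp: rooted_colorings_iff PiE_iff extensional_def)
    moreover have "(i, j) \<in> parcs (path_graph N)" "(j, i) \<in> parcs (path_graph N)"
      using j assms(2) by (auto simp: path_graph_def)
    ultimately show "f \<in> ?A"
      using S T by (auto simp: rooted_colorings_iff PiE_iff extensional_def)
  qed
qed

lemma card_rooted_colorings:
  "rt_distinct t \<Longrightarrow> i < N \<Longrightarrow> int (card (rooted_colorings N t i)) = weight N t i"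
proof (induction t arbitrary: i)
  case (Vertex v)
  have "rooted_colorings N (Vertex v) i = {\<lambda>x\<in>{v}. i}"
    using Vertex(2) by (auto simp: rooted_colorings_iff PiE_iff extensional_def fun_eq_iff)
  then show ?case by simp
next
  case (Graft s t)
  let ?J = "{j. j < N \<and> (j = Suc i \<or> i = Suc j)}"
  have "card (rooted_colorings N (Graft s t) i) =
      card (rooted_colorings N s i) * card (\<Union>j\<in>?J. rooted_colorings N t j)"
    using Graft.prems
    by (subst bij_betw_same_card[OF bij_betw_rooted_colorings_Graft]) (auto simp: card_cartesian_product)
  \<comment> \<open>The color of the root tells the sets apart, so the union is disjoint.\<close>
  also have "card (\<Union>j\<in>?J. rooted_colorings N t j) = (\<Sum>j\<in>?J. card (rooted_colorings N t j))"
    by (rule card_UN_disjoint) (auto simp: finite_rooted_colorings, auto simp: rooted_colorings_def)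
  finally show ?case
    using Graft by (simp add: step_def)
qed

lemma hom_count_rt_graph:
  assumes "rt_distinct t"
  shows "int (hom_count (rt_graph t) (path_graph N)) = (\<Sum>i<N. weight N t i)"
proof -
  have "colorings (rt_graph t) (path_graph N) = (\<Union>i<N. rooted_colorings N t i)"
    using rt_root_in_verts by (fastforce simp: rooted_colorings_def colorings_def path_graph_def)
  then have "hom_count (rt_graph t) (path_graph N) = card (\<Union>i<N. rooted_colorings N t i)"
    by (simp add: hom_count_def)
  also have "\<dots> = (\<Sum>i<N. card (rooted_colorings N t i))"
    by (rule card_UN_disjoint) (auto simp: finite_rooted_colorings, auto simp: rooted_colorings_def)
  finally show ?thesis using assms by (simp add: card_rooted_colorings)
qed

section \<open>Recognizing paths\<close>

text \<open>Describing paths by vertex lists turns joining and reversing them into list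
  operations.\<close>

fun list_arcs :: "'a list \<Rightarrow> ('a \<times> 'a) set" where
  "list_arcs (x # y # zs) = {(x, y), (y, x)} \<union> list_arcs (y # zs)"
| "list_arcs _ = {}"

lemma list_arcs_append:
  "xs \<noteq> [] \<Longrightarrow> ys \<noteq> [] \<Longrightarrow>
    list_arcs (xs @ ys) = list_arcs xs \<union> list_arcs ys \<union> {(last xs, hd ys), (hd ys, last xs)}"
proof (induction xs rule: list_arcs.induct)
  case ("2_2" v)
  then show ?case by (cases ys) auto
qed auto

lemma list_arcs_rev: "list_arcs (rev xs) = list_arcs xs"
proof (induction xs rule: list_arcs.induct)
  case (1 x y zs)
  have "list_arcs (rev (x # y # zs)) = list_arcs (rev (y # zs) @ [x])" by simp
  also have "\<dots> = list_arcs (rev (y # zs)) \<union> {(y, x), (x, y)}"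
    by (subst list_arcs_append) auto
  finally show ?case using 1 by auto
qed auto

lemma list_arcs_map: "list_arcs (map f xs) = map_prod f f ` list_arcs xs"
  by (induction xs rule: list_arcs.induct) auto

lemma list_arcs_upt: "list_arcs [0..<n] = parcs (path_graph n)"
proof (induction n)
  case (Suc n)
  show ?case
  proof (cases n)
    case (Suc k)
    have "list_arcs [0..<Suc n] = list_arcs ([0..<n] @ [n])" by simp
    also have "\<dots> = parcs (path_graph n) \<union> {(k, n), (n, k)}"
      unfolding Suc.IH[symmetric] using Suc by (subst list_arcs_append) simp_all
    also have "\<dots> = parcs (path_graph (Suc n))"
      using Suc by (auto simp: path_graph_def)
    finally show ?thesis .
  qed (auto simp: path_graph_def)
qed (simp add: path_graph_def)

lemma digraph_iso_path_graph:
  assumes "distinct xs" "pverts T = set xs" "parcs T = list_arcs xs"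
  shows "digraph_iso (with_proj T) (with_proj (path_graph (length xs)))"
proof -
  let ?n = "length xs"
  interpret P: pair_graph "path_graph ?n" by (rule pair_graph_path_graph)
  \<comment> \<open>The isomorphism runs from the standard path to \<open>T\<close>, sending a
    position to the entry there; its direction is reversed at the end.\<close>
  define f where "f = \<lparr>iso_verts = (!) xs, iso_arcs = map_prod ((!) xs) ((!) xs),
    iso_head = snd, iso_tail = (fst :: 'a \<times> 'a \<Rightarrow> 'a)\<rparr>"
  have xs: "map ((!) xs) [0..<?n] = xs" by (rule map_nth)
  have inj: "inj_on ((!) xs) {..<?n}"
    using assms(1) by (intro inj_on_nth) auto
  have sub: "parcs (path_graph ?n) \<subseteq> {..<?n} \<times> {..<?n}"
    by (auto simp: path_graph_def)
  have V: "pverts (path_graph ?n) = {..<?n}" by (simp add: path_graph_def)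
  have "P.digraph_isomorphism f"
    unfolding P.digraph_isomorphism_def
    using inj inj_on_subset[OF map_prod_inj_on[OF inj inj] sub] V P.wf_digraph_axioms
    by (auto simp: f_def)
  moreover have "with_proj T = app_iso f (with_proj (path_graph ?n))"
  proof -
    have "set xs = (!) xs ` {..<?n}"
      by (subst xs[symmetric]) (simp only: set_map set_upt atLeast0LessThan)
    moreover have "list_arcs xs = map_prod ((!) xs) ((!) xs) ` parcs (path_graph ?n)"
      by (subst xs[symmetric]) (simp only: list_arcs_map list_arcs_upt)
    ultimately show ?thesis
      by (simp add: app_iso_def f_def with_proj_def assms V)
  qed
  ultimately have "digraph_iso (with_proj (path_graph ?n)) (with_proj T)"
    unfolding digraph_iso_def by blast
  then show ?thesis by (rule digraph_iso_swap[OF P.wf_digraph_axioms])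
qed

text \<open>Rooted trees are nonempty, so the value at \<open>[]\<close> is a mere default.\<close>

fun path_tree :: "'a list \<Rightarrow> 'a rtree" where
  "path_tree (x # y # zs) = Graft (Vertex x) (path_tree (y # zs))"
| "path_tree [x] = Vertex x"
| "path_tree [] = undefined"

lemma path_tree_simps:
  assumes "xs \<noteq> []"
  shows "rt_root (path_tree xs) = hd xs" "rt_verts (path_tree xs) = set xs"
    "rt_arcs (path_tree xs) = list_arcs xs" "rt_size (path_tree xs) = length xs"
    "rt_distinct (path_tree xs) \<longleftrightarrow> distinct xs" "end_path (path_tree xs)"
  using assms by (induction xs rule: path_tree.induct) auto

lemma end_path_imp_path_tree: "end_path t \<Longrightarrow> \<exists>xs. xs \<noteq> [] \<and> t = path_tree xs"
proof (induction t)
  case (Vertex v)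
  show ?case by (rule exI[of _ "[v]"]) simp
next
  case (Graft s t)
  then obtain v ys where "s = Vertex v" "ys \<noteq> []" "t = path_tree ys" by auto
  then show ?case by (intro exI[of _ "v # ys"]) (cases ys; simp)
qed

lemma path_like_imp_list:
  assumes "path_like t" "rt_distinct t"
  shows "\<exists>xs. distinct xs \<and> rt_verts t = set xs \<and> rt_arcs t = list_arcs xs"
proof (cases t)
  case (Vertex v)
  then show ?thesis by (intro exI[of _ "[v]"]) simp
next
  case (Graft s1 s2)
  then obtain xs ys where "xs \<noteq> []" "s1 = path_tree xs" "ys \<noteq> []" "s2 = path_tree ys"
    using assms(1) end_path_imp_path_tree by (metis path_like.simps(2))
  \<comment> \<open>Both lists start at the roots being joined; reversing the first makes these
    roots consecutive.\<close>
  then show ?thesis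
    using assms(2) Graft
    by (intro exI[of _ "rev xs @ ys"])
      (auto simp: path_tree_simps list_arcs_append list_arcs_rev last_rev)
qed

lemma path_like_imp_iso:
  assumes "path_like t" "rt_distinct t"
  shows "digraph_iso (with_proj (rt_graph t)) (with_proj (path_graph (rt_size t)))"
proof -
  obtain xs where xs: "distinct xs" "rt_verts t = set xs" "rt_arcs t = list_arcs xs"
    using path_like_imp_list[OF assms] by blast
  then have "length xs = rt_size t"
    using card_rt_verts[OF assms(2)] distinct_card[OF xs(1)] by simp
  then show ?thesis using digraph_iso_path_graph[of xs "rt_graph t"] xs by simp
qed

section \<open>Comparing the coloring counts of trees and paths\<close>

lemma hom_count_path_graph:
  assumes "1 \<le> n"
  shows "int (hom_count (path_graph n) (path_graph N)) = (\<Sum>i<N. (step N ^^ (n - 1)) (\<lambda>_. 1) i)"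
proof -
  have ne: "[0..<n] \<noteq> []" using assms by simp
  have "path_graph n = rt_graph (path_tree [0..<n])"
    unfolding rt_graph_def path_tree_simps(2,3)[OF ne] list_arcs_upt
    by (simp add: path_graph_def atLeast0LessThan)
  moreover have "weight N (path_tree [0..<n]) = (step N ^^ (n - 1)) (\<lambda>_. 1)"
    using weight_end_path[OF path_tree_simps(6)[OF ne]] unfolding path_tree_simps(4)[OF ne] by simp
  moreover have "rt_distinct (path_tree [0..<n])"
    unfolding path_tree_simps(5)[OF ne] by simp
  ultimately show ?thesis using hom_count_rt_graph by metis
qed

lemma end_path_imp_path_like: "end_path t \<Longrightarrow> path_like t"
  by (cases t) auto

lemma hom_count_path_graph_le:
  assumes "T \<in> trees_on n" "1 \<le> n"
  shows "hom_count (path_graph n) (path_graph (2 * m)) \<le> hom_count T (path_graph (2 * m))"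
proof -
  obtain t where t: "rt_distinct t" "T = rt_graph t"
    using assms(1) undirected_tree_eq_rt_graph by (auto simp: trees_on_def)
  then have "rt_size t = n"
    using assms(1) card_rt_verts[of t] by (simp add: trees_on_def)
  \<comment> \<open>The constant root weight \<open>1\<close> turns weighted sums into numbers of
    colorings.\<close>
  then have "int (hom_count (path_graph n) (path_graph (2 * m)))
      \<le> int (hom_count T (path_graph (2 * m)))"
    using sum_weight_ge[OF graded_one, where m = m and t = t]
    by (simp add: hom_count_path_graph[OF assms(2)] hom_count_rt_graph[OF t(1)] t(2))
  then show ?thesis by simp
qed

lemma hom_count_path_graph_less:
  assumes "T \<in> trees_on n" "1 \<le> n" "2 \<le> m"
    and "\<not> digraph_iso (with_proj T) (with_proj (path_graph n))"
  shows "hom_count (path_graph n) (path_graph (2 * m)) < hom_count T (path_graph (2 * m))"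
proof -
  obtain t where t: "rt_distinct t" "T = rt_graph t"
    using assms(1) undirected_tree_eq_rt_graph by (auto simp: trees_on_def)
  then have n: "rt_size t = n"
    using assms(1) card_rt_verts[of t] by (simp add: trees_on_def)
  have "\<not> path_like t"
    using path_like_imp_iso[of t] t n assms(4) by auto
  \<comment> \<open>The constant weight is not strict at the end, so strictness comes from
    \<open>t\<close> not being a path.\<close>
  then have "int (hom_count (path_graph n) (path_graph (2 * m)))
      < int (hom_count T (path_graph (2 * m)))"
    using sum_weight_gr[OF graded_one assms(3), where t = t] end_path_imp_path_like[of t] n
    by (auto simp: hom_count_path_graph[OF assms(2)] hom_count_rt_graph[OF t(1)] t(2))
  then show ?thesis by simp
qed

theorem theorem4p6:
  shows "(\<forall>m::nat. m \<ge> 1 \<longrightarrow> hoffman_london (path_graph (2 * m))) \<and>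
         (\<forall>m::nat. m \<ge> 2 \<longrightarrow> strongly_hoffman_london (path_graph (2 * m)))"
proof (intro conjI allI impI)
  fix m :: nat
  show "hoffman_london (path_graph (2 * m))"
    unfolding hoffman_london_def
  proof (intro allI impI)
    fix n :: nat assume n: "1 \<le> n"
    show "hom_count (path_graph n) (path_graph (2 * m)) =
        Min ((\<lambda>T. hom_count T (path_graph (2 * m))) ` trees_on n)"
      using path_graph_in_trees_on[OF n]
      by (intro Min_eqI[symmetric]) (auto simp: finite_trees_on intro: hom_count_path_graph_le[OF _ n])
  qed
next
  fix m :: nat assume "2 \<le> m"
  then show "strongly_hoffman_london (path_graph (2 * m))"
    unfolding strongly_hoffman_london_def using hom_count_path_graph_less by blast
qed

end
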